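(* Let $(V,\Phi)$ be the 2-dimensional $\ell$EAS with basis $(e_1,e_2)$ of $V$, where the matrix of $\Phi$ in the basis $(e_1\otimes e_1,e_1\otimes e_2,e_2\otimes e_1,e_2\otimes e_2)$ is $$\begin{pmatrix}1&0&0&0\\0&0&1&0\\0&0&0&0\\0&0&0&1\end{pmatrix}.$$ Writing $*_i=*_{e_i}$, any $\Phi$-associative algebra is a duplicial algebra, with $*_1=\prec$ and $*_2=\succ$, and any opposite $\Phi$-associative algebra is a duplicial algebra, with $*_1=\succ$ and $*_2=\prec$.
   Context: All vector spaces are over a field $\mathbb{K}$. Columns of the matrix are images of basis vectors: $\Phi(e_1\otimes e_1)=e_1\otimes e_1$, $\Phi(e_1\otimes e_2)=0$, $\Phi(e_2\otimes e_1)=e_1\otimes e_2$, $\Phi(e_2\otimes e_2)=e_2\otimes e_2$. $(V,\Phi)$ is an $\ell$EAS if $(\mathrm{Id}\otimes\Phi)\circ(\Phi\otimes\mathrm{Id})\circ(\mathrm{Id}\otimes\Phi)=(\Phi\otimes\mathrm{Id})\circ(\mathrm{Id}\otimes\tau)\circ(\Phi\otimes\mathrm{Id})$ on $V^{\otimes 3}$, with $\tau(a\otimes b)=b\otimes a$. Write $\Phi(a\otimes b)=\sum a'\rightarrow b'\otimes a''\triangleright b''$ symbolically. A vector space $A$ with bilinear products $*_a$, linear in $a\in V$, is a $\Phi$-associative algebra if $x*_a(y*_bz)=\sum(x*_{a''\triangleright b''}y)*_{a'\rightarrow b'}z$ for all $x,y,z\in A$ and $a,b\in V$, and an opposite $\Phi$-associative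 algebra if $\sum x*_{a'\rightarrow b'}(y*_{a''\triangleright b''}z)=(x*_by)*_az$. A duplicial algebra is $(A,\prec,\succ)$ with bilinear products such that $(x\prec y)\prec z=x\prec(y\prec z)$, $(x\succ y)\prec z=x\succ(y\prec z)$, $x\succ(y\succ z)=(x\succ y)\succ z$ for all $x,y,z\in A$. *)

theory Defs
  imports Complex_Main "Jordan_Normal_Form.Matrix"
begin

text \<open>
  Every vector space is a whole type together with its scalar multiplication by the field
  \<open>'k\<close> (library locale \<open>vector_space\<close>).
\<close>

definition bilinear_map ::
  "('k::field \<Rightarrow> 'u::ab_group_add \<Rightarrow> 'u) \<Rightarrow> ('k \<Rightarrow> 'w::ab_group_add \<Rightarrow> 'w) \<Rightarrow>
   ('k \<Rightarrow> 'x::ab_group_add \<Rightarrow> 'x) \<Rightarrow> ('u \<Rightarrow> 'w \<Rightarrow> 'x) \<Rightarrow> bool"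
  where "bilinear_map sU sW sX \<beta> \<longleftrightarrow>
    (\<forall>u. Vector_Spaces.linear sW sX (\<beta> u)) \<and> (\<forall>w. Vector_Spaces.linear sU sX (\<lambda>u. \<beta> u w))"

text \<open>
  \<open>(T, \<otimes>)\<close> is a tensor product of \<open>U\<close> and \<open>W\<close>. A locale cannot quantify over the type of
  the target in the universal property, so the property is required for bilinear maps into
  \<open>'k\<close>, with uniqueness of the linear factor expressed by pure tensors spanning \<open>T\<close>.
  The universal property for an arbitrary target is the lemma \<open>ex1_lift\<close> below.
\<close>

locale tensor_product =
  U: vector_space sU + W: vector_space sW + T: vector_space sT
  for sU :: "'k::field \<Rightarrow> 'u::ab_group_add \<Rightarrow> 'u"
    and sW :: "'k \<Rightarrow> 'w::ab_group_add \<Rightarrow> 'w"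
    and sT :: "'k \<Rightarrow> 't::ab_group_add \<Rightarrow> 't" +
  fixes tens :: "'u \<Rightarrow> 'w \<Rightarrow> 't"
  assumes bilinear_tens: "bilinear_map sU sW sT tens"
    and span_tens: "T.span {tens u w | u w. True} = UNIV"
    and form_factors: "bilinear_map sU sW (*) \<beta> \<Longrightarrow>
      \<exists>f. Vector_Spaces.linear sT (*) f \<and> (\<forall>u w. f (tens u w) = \<beta> u w)"

text \<open>
  The linear map \<open>f\<close> on the tensor product with \<open>f (u \<otimes> w) = \<beta> u w\<close>, for bilinear \<open>\<beta>\<close>. If \<open>t\<close>
  is written symbolically as \<open>\<Sum> t' \<otimes> t''\<close>, then \<open>tensor_lift sT sX tens \<beta> t\<close> is
  \<open>\<Sum> \<beta> t' t''\<close>.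
\<close>

definition tensor_lift ::
  "('k::field \<Rightarrow> 't::ab_group_add \<Rightarrow> 't) \<Rightarrow> ('k \<Rightarrow> 'x::ab_group_add \<Rightarrow> 'x) \<Rightarrow>
   ('u \<Rightarrow> 'w \<Rightarrow> 't) \<Rightarrow> ('u \<Rightarrow> 'w \<Rightarrow> 'x) \<Rightarrow> 't \<Rightarrow> 'x"
  where "tensor_lift sT sX tens \<beta> =
    (THE f. Vector_Spaces.linear sT sX f \<and> (\<forall>u w. f (tens u w) = \<beta> u w))"

lemma (in tensor_product) linear_eq_if_eq_tens:
  assumes "Vector_Spaces.linear sT sX f" "Vector_Spaces.linear sT sX g"
    and "\<And>u w. f (tens u w) = g (tens u w)"
  shows "f = g"
proof
  fix x
  interpret vector_space_pair sT sX
    using assms(1) by (simp add: vector_space_pair_def Vector_Spaces.linear_def)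
  show "f x = g x"
    by (rule linear_eq_on[OF assms(1,2), where B = "{tens u w | u w. True}"])
      (use span_tens assms(3) in auto)
qed

lemma (in tensor_product) ex1_lift:
  fixes sX :: "'k \<Rightarrow> 'x::ab_group_add \<Rightarrow> 'x"
  assumes X: "vector_space sX" and \<beta>: "bilinear_map sU sW sX \<beta>"
  shows "\<exists>!f. Vector_Spaces.linear sT sX f \<and> (\<forall>u w. f (tens u w) = \<beta> u w)"
proof -
  interpret X: vector_space sX by (rule X)
  interpret TX: vector_space_pair sT sX by unfold_locales
  have K: "vector_space ((*) :: 'k \<Rightarrow> 'k \<Rightarrow> 'k)"
    by unfold_locales (auto simp: algebra_simps)
  interpret K: vector_space "(*) :: 'k \<Rightarrow> 'k \<Rightarrow> 'k" by (rule K)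
  interpret XK: vector_space_pair sX "(*) :: 'k \<Rightarrow> 'k \<Rightarrow> 'k" by unfold_locales
  interpret TK: vector_space_pair sT "(*) :: 'k \<Rightarrow> 'k \<Rightarrow> 'k" by unfold_locales
  obtain B where B: "B \<subseteq> {tens u w | u w. True}" "T.independent B"
      "{tens u w | u w. True} \<subseteq> T.span B"
    by (rule T.maximal_independent_subset)
  have spB: "T.span B = UNIV"
    using T.span_minimal[OF B(3) T.subspace_span] span_tens by auto
  have "\<forall>b\<in>B. \<exists>p. b = tens (fst p) (snd p)" using B(1) by fastforce
  then obtain p where p: "\<And>b. b \<in> B \<Longrightarrow> b = tens (fst (p b)) (snd (p b))"
    by metis
  define f where "f = TX.construct B (\<lambda>b. \<beta> (fst (p b)) (snd (p b)))"
  have f: "Vector_Spaces.linear sT sX f"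
    unfolding f_def by (rule TX.linear_construct[OF B(2)])
  have fB: "f b = \<beta> (fst (p b)) (snd (p b))" if "b \<in> B" for b
    unfolding f_def using that by (rule TX.construct_basis[OF B(2)])
  have "f (tens u w) = \<beta> u w" for u w
  proof (rule ccontr)
    define d where "d = f (tens u w) - \<beta> u w"
    assume "f (tens u w) \<noteq> \<beta> u w"
    then have "X.independent {d}" by (simp add: d_def)
    from XK.linear_independent_extend[OF this, of "\<lambda>_. 1"]
    obtain \<phi> where \<phi>: "Vector_Spaces.linear sX (*) \<phi>" "\<phi> d = 1" by auto
    have "bilinear_map sU sW (*) (\<lambda>u w. \<phi> (\<beta> u w))"
      using \<beta> unfolding bilinear_map_def
      by (auto intro: Vector_Spaces.linear_compose[OF _ \<phi>(1), unfolded o_def])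
    from form_factors[OF this] obtain g where g: "Vector_Spaces.linear sT (*) g"
      "\<And>u w. g (tens u w) = \<phi> (\<beta> u w)" by auto
    have "g (tens u w) = (\<phi> \<circ> f) (tens u w)"
    proof (rule TK.linear_eq_on[OF g(1) Vector_Spaces.linear_compose[OF f \<phi>(1)], where B = B])
      show "tens u w \<in> T.span B" using spB by simp
      show "g b = (\<phi> \<circ> f) b" if "b \<in> B" for b
        using fB[OF that] g(2)[of "fst (p b)" "snd (p b)"] p[OF that] by simp
    qed
    then have "\<phi> d = 0"
      unfolding d_def using XK.linear_diff[OF \<phi>(1)] g(2) by simp
    with \<phi>(2) show False by simp
  qed
  with f show ?thesis by (intro ex1I[of _ f]) (auto intro: linear_eq_if_eq_tens)
qed

lemma (in tensor_product)
  assumes "vector_space sX" and "bilinear_map sU sW sX \<beta>"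
  shows linear_tensor_lift: "Vector_Spaces.linear sT sX (tensor_lift sT sX tens \<beta>)"
    and tensor_lift_tens: "tensor_lift sT sX tens \<beta> (tens u w) = \<beta> u w"
  using theI'[OF ex1_lift[OF assms]] unfolding tensor_lift_def by blast+

text \<open>
  \<open>V2\<close> is \<open>V \<otimes> V\<close>, and \<open>V3\<close> is both \<open>V \<otimes> (V \<otimes> V)\<close> (via \<open>tensL\<close>) and \<open>(V \<otimes> V) \<otimes> V\<close> (via \<open>tensR\<close>),
  the two being identified by \<open>a \<otimes> (b \<otimes> c) = (a \<otimes> b) \<otimes> c\<close>.
\<close>

locale tensor_cube =
  V2: tensor_product sV sV sV2 tens +
  V3l: tensor_product sV sV2 sV3 tensL +
  V3r: tensor_product sV2 sV sV3 tensR
  for sV :: "'k::field \<Rightarrow> 'v::ab_group_add \<Rightarrow> 'v"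
    and sV2 :: "'k \<Rightarrow> 'v2::ab_group_add \<Rightarrow> 'v2"
    and sV3 :: "'k \<Rightarrow> 'v3::ab_group_add \<Rightarrow> 'v3"
    and tens :: "'v \<Rightarrow> 'v \<Rightarrow> 'v2" and tensL :: "'v \<Rightarrow> 'v2 \<Rightarrow> 'v3" and tensR :: "'v2 \<Rightarrow> 'v \<Rightarrow> 'v3" +
  assumes tens_assoc: "tensL a (tens b c) = tensR (tens a b) c"

text \<open>\<open>flip\<close> is \<open>\<tau>\<close>, \<open>id_tensor F\<close> is \<open>Id \<otimes> F\<close> and \<open>tensor_id F\<close> is \<open>F \<otimes> Id\<close>.\<close>

definition flip where
  "flip sV2 tens = tensor_lift sV2 sV2 tens (\<lambda>a b. tens b a)"

definition id_tensor where
  "id_tensor sV3 tensL F = tensor_lift sV3 sV3 tensL (\<lambda>a t. tensL a (F t))"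

definition tensor_id where
  "tensor_id sV3 tensR F = tensor_lift sV3 sV3 tensR (\<lambda>t c. tensR (F t) c)"

locale lEAS = tensor_cube sV sV2 sV3 tens tensL tensR
  for sV :: "'k::field \<Rightarrow> 'v::ab_group_add \<Rightarrow> 'v"
    and sV2 :: "'k \<Rightarrow> 'v2::ab_group_add \<Rightarrow> 'v2"
    and sV3 :: "'k \<Rightarrow> 'v3::ab_group_add \<Rightarrow> 'v3"
    and tens tensL tensR +
  fixes \<Phi> :: "'v2 \<Rightarrow> 'v2"
  assumes linear_Phi: "Vector_Spaces.linear sV2 sV2 \<Phi>"
    and braid: "id_tensor sV3 tensL \<Phi> \<circ> tensor_id sV3 tensR \<Phi> \<circ> id_tensor sV3 tensL \<Phi> =
      tensor_id sV3 tensR \<Phi> \<circ> id_tensor sV3 tensL (flip sV2 tens) \<circ> tensor_id sV3 tensR \<Phi>"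

definition ordered_basis :: "('k::field \<Rightarrow> 'v::ab_group_add \<Rightarrow> 'v) \<Rightarrow> 'v list \<Rightarrow> bool"
  where "ordered_basis sV bs \<longleftrightarrow> vector_space sV \<and> distinct bs \<and>
    \<not> Modules.module.dependent sV (set bs) \<and> Modules.module.span sV (set bs) = UNIV"

text \<open>Column \<open>j\<close> of the matrix holds the coordinates of the image of the \<open>j\<close>-th basis vector.\<close>

definition has_matrix ::
  "('k::field \<Rightarrow> 'v::ab_group_add \<Rightarrow> 'v) \<Rightarrow> 'v list \<Rightarrow> ('v \<Rightarrow> 'v) \<Rightarrow> 'k mat \<Rightarrow> bool"
  where "has_matrix sV bs F M \<longleftrightarrow> M \<in> carrier_mat (length bs) (length bs) \<and>
    (\<forall>j<length bs. F (bs ! j) = (\<Sum>i<length bs. sV (M $$ (i, j)) (bs ! i)))"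

text \<open>
  The linear map with this matrix satisfies the identity \<open>braid\<close>, so assuming \<open>lEAS\<close> for it
  excludes nothing.
\<close>

lemma (in tensor_cube) lEAS_if_has_matrix:
  assumes bas: "ordered_basis sV [e1, e2]"
    and lin: "Vector_Spaces.linear sV2 sV2 \<Phi>"
    and mat: "has_matrix sV2 [tens e1 e1, tens e1 e2, tens e2 e1, tens e2 e2] \<Phi>
      (mat_of_rows_list 4
        [[1, 0, 0, 0],
         [0, 0, 1, 0],
         [0, 0, 0, 0],
         [0, 0, 0, 1]])"
  shows "lEAS sV sV2 sV3 tens tensL tensR \<Phi>"
proof -
  have v2: "vector_space sV2" and v3: "vector_space sV3" and v: "vector_space sV"
    by unfold_locales
  interpret P2: vector_space_pair sV sV2 by unfold_locales
  interpret P3: vector_space_pair sV sV3 by unfold_locales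
  interpret P23: vector_space_pair sV2 sV3 by unfold_locales
  interpret \<Phi>: Vector_Spaces.linear sV2 sV2 \<Phi> by (rule lin)
  have "\<forall>j<4. \<Phi> ([tens e1 e1, tens e1 e2, tens e2 e1, tens e2 e2] ! j) =
      [tens e1 e1, 0, tens e1 e2, tens e2 e2] ! j"
    using mat unfolding has_matrix_def mat_of_rows_list_def
    by (auto simp: numeral_eq_Suc less_Suc_eq)
  then have \<Phi>11: "\<Phi> (tens e1 e1) = tens e1 e1" and \<Phi>12: "\<Phi> (tens e1 e2) = 0"
    and \<Phi>21: "\<Phi> (tens e2 e1) = tens e1 e2" and \<Phi>22: "\<Phi> (tens e2 e2) = tens e2 e2"
    by (simp_all add: numeral_eq_Suc All_less_Suc)
  note bil = V2.bilinear_tens V3l.bilinear_tens V3r.bilinear_tens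
  have id_tensor_bil: "bilinear_map sV sV2 sV3 (\<lambda>a t. tensL a (F t))"
    and tensor_id_bil: "bilinear_map sV2 sV sV3 (\<lambda>t c. tensR (F t) c)"
    if "Vector_Spaces.linear sV2 sV2 F" for F
    using V3l.bilinear_tens V3r.bilinear_tens
    unfolding bilinear_map_def by (auto intro: Vector_Spaces.linear_compose[OF that, unfolded o_def])
  have flip_bil: "bilinear_map sV sV sV2 (\<lambda>a b. tens b a)"
    using V2.bilinear_tens unfolding bilinear_map_def by auto
  have lflip: "Vector_Spaces.linear sV2 sV2 (flip sV2 tens)"
    unfolding flip_def by (rule V2.linear_tensor_lift[OF v2 flip_bil])
  have flip: "flip sV2 tens (tens a b) = tens b a" for a b
    unfolding flip_def by (rule V2.tensor_lift_tens[OF v2 flip_bil])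
  have L: "id_tensor sV3 tensL F (tensL a t) = tensL a (F t)"
       "Vector_Spaces.linear sV3 sV3 (id_tensor sV3 tensL F)"
       "tensor_id sV3 tensR F (tensR t a) = tensR (F t) a"
       "Vector_Spaces.linear sV3 sV3 (tensor_id sV3 tensR F)"
    if "Vector_Spaces.linear sV2 sV2 F" for F a t
    unfolding id_tensor_def tensor_id_def
    by (rule V3l.tensor_lift_tens[OF v3 id_tensor_bil[OF that]]
        V3l.linear_tensor_lift[OF v3 id_tensor_bil[OF that]]
        V3r.tensor_lift_tens[OF v3 tensor_id_bil[OF that]]
        V3r.linear_tensor_lift[OF v3 tensor_id_bil[OF that]])+
  let ?l = "id_tensor sV3 tensL \<Phi> \<circ> tensor_id sV3 tensR \<Phi> \<circ> id_tensor sV3 tensL \<Phi>"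
  let ?r = "tensor_id sV3 tensR \<Phi> \<circ> id_tensor sV3 tensL (flip sV2 tens) \<circ> tensor_id sV3 tensR \<Phi>"
  have lr: "Vector_Spaces.linear sV3 sV3 ?l" "Vector_Spaces.linear sV3 sV3 ?r"
    using Vector_Spaces.linear_compose[OF Vector_Spaces.linear_compose[OF L(2)[OF lin] L(4)[OF lin]] L(2)[OF lin]]
      Vector_Spaces.linear_compose[OF Vector_Spaces.linear_compose[OF L(4)[OF lin] L(2)[OF lflip]] L(4)[OF lin]]
    by (simp_all add: comp_assoc)
  have lL: "Vector_Spaces.linear sV2 sV3 (tensL a)" "Vector_Spaces.linear sV sV3 (\<lambda>a. tensL a t)"
     "Vector_Spaces.linear sV sV2 (tens b)" "Vector_Spaces.linear sV sV2 (\<lambda>a. tens a b)"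
     "Vector_Spaces.linear sV2 sV3 (\<lambda>t. tensR t b)" for a b t
    using bil unfolding bilinear_map_def by auto
  have z: "tensL a 0 = 0" "tensR 0 b = 0" for a b
    using P23.linear_0[OF lL(1)] P23.linear_0[OF lL(5)] by auto
  have z3: "id_tensor sV3 tensL \<Phi> 0 = 0" "tensor_id sV3 tensR \<Phi> 0 = 0"
     "id_tensor sV3 tensL (flip sV2 tens) 0 = 0"
    using L(2)[OF lin] L(4)[OF lin] L(2)[OF lflip]
    by (auto dest: module_hom.zero simp: linear_iff_module_hom)
  have cR: "id_tensor sV3 tensL F (tensR (tens a b) c) = tensL a (F (tens b c))"
    if "Vector_Spaces.linear sV2 sV2 F" for F a b c
    using L(1)[OF that] by (metis tens_assoc)
  have ne: "e1 \<noteq> e2" "e2 \<noteq> e1" and sp: "V2.U.span {e1, e2} = UNIV"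
    using bas by (auto simp: ordered_basis_def)
  have base: "?l (tensL a (tens b c)) = ?r (tensL a (tens b c))"
    if "a \<in> {e1, e2}" "b \<in> {e1, e2}" "c \<in> {e1, e2}" for a b c
    using that ne
    by (auto simp: L[OF lin] L[OF lflip] tens_assoc cR[OF lin] cR[OF lflip] flip z z3
        \<Phi>11 \<Phi>12 \<Phi>21 \<Phi>22)
  note lc = Vector_Spaces.linear_compose[unfolded o_def]
  have ext: "f = g" if "Vector_Spaces.linear sV sV3 f" "Vector_Spaces.linear sV sV3 g"
    "f e1 = g e1" "f e2 = g e2" for f g
    using P3.linear_eq_on[OF that(1,2), of _ "{e1, e2}"] sp that(3,4) by auto
  have lf: "Vector_Spaces.linear sV sV3 (\<lambda>a. F (tensL a t))"
    "Vector_Spaces.linear sV sV3 (\<lambda>b. F (tensL a (tens b c)))"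
    "Vector_Spaces.linear sV sV3 (\<lambda>c. F (tensL a (tens b c)))"
    "Vector_Spaces.linear sV2 sV3 (\<lambda>t. F (tensL a t))"
    if "Vector_Spaces.linear sV3 sV3 F" for F a b c t
    by (rule lc[OF _ that] lc[OF _ lL(1)] lL)+
  have 1: "?l (tensL a (tens b c)) = ?r (tensL a (tens b c))"
    if "a \<in> {e1, e2}" "b \<in> {e1, e2}" for a b c
    by (rule fun_cong[of _ _ c], rule ext[OF lf(3)[OF lr(1)] lf(3)[OF lr(2)]])
      (use base that in blast)+
  have 2: "?l (tensL a (tens b c)) = ?r (tensL a (tens b c))" if "a \<in> {e1, e2}" for a b c
    by (rule fun_cong[of _ _ b], rule ext[OF lf(2)[OF lr(1)] lf(2)[OF lr(2)]])
      (use 1 that in blast)+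
  have "?l (tensL a (tens b c)) = ?r (tensL a (tens b c))" for a b c
    by (rule fun_cong[of _ _ a], rule ext[OF lf(1)[OF lr(1)] lf(1)[OF lr(2)]])
      (use 2 in blast)+
  then have "(\<lambda>t. ?l (tensL a t)) = (\<lambda>t. ?r (tensL a t))" for a
    by (intro V2.linear_eq_if_eq_tens[OF lf(4)[OF lr(1)] lf(4)[OF lr(2)]])
  then have "?l = ?r"
    by (intro V3l.linear_eq_if_eq_tens[OF lr]) (rule fun_cong)
  then show ?thesis using lin by unfold_locales
qed

definition products_linear ::
  "('k::field \<Rightarrow> 'v::ab_group_add \<Rightarrow> 'v) \<Rightarrow> ('k \<Rightarrow> 'a::ab_group_add \<Rightarrow> 'a) \<Rightarrow>
   ('v \<Rightarrow> 'a \<Rightarrow> 'a \<Rightarrow> 'a) \<Rightarrow> bool"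
  where "products_linear sV sA star \<longleftrightarrow> vector_space sA \<and>
    (\<forall>a. bilinear_map sA sA sA (star a)) \<and>
    (\<forall>x y. Vector_Spaces.linear sV sA (\<lambda>a. star a x y))"

text \<open>
  \<open>star a x y\<close> stands for \<open>x *\<^sub>a y\<close>. In the lifted functions, \<open>c\<close> and \<open>d\<close> are the left and right
  tensor factors of \<open>\<Phi> (a \<otimes> b)\<close>, i.e. \<open>a' \<rightarrow> b'\<close> and \<open>a'' \<triangleright> b''\<close> respectively.
\<close>

definition Phi_associative ::
  "('k::field \<Rightarrow> 'v::ab_group_add \<Rightarrow> 'v) \<Rightarrow> ('k \<Rightarrow> 'v2::ab_group_add \<Rightarrow> 'v2) \<Rightarrow>
   ('v \<Rightarrow> 'v \<Rightarrow> 'v2) \<Rightarrow> ('v2 \<Rightarrow> 'v2) \<Rightarrow>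
   ('k \<Rightarrow> 'a::ab_group_add \<Rightarrow> 'a) \<Rightarrow> ('v \<Rightarrow> 'a \<Rightarrow> 'a \<Rightarrow> 'a) \<Rightarrow> bool"
  where "Phi_associative sV sV2 tens \<Phi> sA star \<longleftrightarrow> products_linear sV sA star \<and>
    (\<forall>x y z a b. star a x (star b y z) =
      tensor_lift sV2 sA tens (\<lambda>c d. star c (star d x y) z) (\<Phi> (tens a b)))"

definition opposite_Phi_associative ::
  "('k::field \<Rightarrow> 'v::ab_group_add \<Rightarrow> 'v) \<Rightarrow> ('k \<Rightarrow> 'v2::ab_group_add \<Rightarrow> 'v2) \<Rightarrow>
   ('v \<Rightarrow> 'v \<Rightarrow> 'v2) \<Rightarrow> ('v2 \<Rightarrow> 'v2) \<Rightarrow>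
   ('k \<Rightarrow> 'a::ab_group_add \<Rightarrow> 'a) \<Rightarrow> ('v \<Rightarrow> 'a \<Rightarrow> 'a \<Rightarrow> 'a) \<Rightarrow> bool"
  where "opposite_Phi_associative sV sV2 tens \<Phi> sA star \<longleftrightarrow> products_linear sV sA star \<and>
    (\<forall>x y z a b. tensor_lift sV2 sA tens (\<lambda>c d. star c x (star d y z)) (\<Phi> (tens a b)) =
      star a (star b x y) z)"

definition duplicial ::
  "('k::field \<Rightarrow> 'a::ab_group_add \<Rightarrow> 'a) \<Rightarrow> ('a \<Rightarrow> 'a \<Rightarrow> 'a) \<Rightarrow> ('a \<Rightarrow> 'a \<Rightarrow> 'a) \<Rightarrow> bool"
  where "duplicial sA prec succ \<longleftrightarrow> vector_space sA \<and>
    bilinear_map sA sA sA prec \<and> bilinear_map sA sA sA succ \<and>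
    (\<forall>x y z. prec (prec x y) z = prec x (prec y z)) \<and>
    (\<forall>x y z. prec (succ x y) z = succ x (prec y z)) \<and>
    (\<forall>x y z. succ x (succ y z) = succ (succ x y) z)"

end

theory Submission
  imports Defs
begin

text \<open>Wherever \<Phi> sends a pure tensor of basis vectors to a pure tensor c \<otimes> d, the
  sum in the defining identity has a single term, and the identity becomes an ordinary law for three
  elements. The columns of e1 \<otimes> e1, e2 \<otimes> e1 and e2 \<otimes> e2 are of this kind.
  The two fixed tensors make \<open>star e1\<close> and \<open>star e2\<close> associative; e2
  \<otimes> e1, sent to e1 \<otimes> e2, gives the mixed law. So the three duplicial axioms are
  three instances of one identity. Evaluating the sum rests on \<open>bilinear_map_products\<close>,
  the images on \<open>matrix_values\<close>.\<close>

lemma matrix_values: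
  assumes "vector_space sW"
    and "has_matrix sW [b1, b2, b3, b4] F
      (mat_of_rows_list 4
        [[1, 0, 0, 0],
         [0, 0, 1, 0],
         [0, 0, 0, 0],
         [0, 0, 0, 1]])"
  shows "F b1 = b1" "F b2 = 0" "F b3 = b2" "F b4 = b4"
proof -
  interpret vector_space sW by (rule assms(1))
  have "\<forall>j<4. F ([b1, b2, b3, b4] ! j) = [b1, 0, b2, b4] ! j"
    using assms(2) unfolding has_matrix_def mat_of_rows_list_def
    by (auto simp: numeral_eq_Suc less_Suc_eq)
  then show "F b1 = b1" "F b2 = 0" "F b3 = b2" "F b4 = b4"
    by (simp_all add: numeral_eq_Suc All_less_Suc)
qed

text \<open>\<open>tensor_lift\<close> is a definite description, so its value on a pure tensor is
  known only once the lifted function is bilinear. Linearity in c is linearity of the products in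
  their index; linearity in d composes this with multiplication by a fixed element.\<close>

lemma bilinear_map_products:
  assumes "products_linear sV sA star"
  shows "bilinear_map sV sV sA (\<lambda>c d. star c (star d x y) z)"
    and "bilinear_map sV sV sA (\<lambda>c d. star c x (star d y z))"
proof -
  have lin: "Vector_Spaces.linear sV sA (\<lambda>a. star a x y)" "Vector_Spaces.linear sA sA (star a x)"
    "Vector_Spaces.linear sA sA (\<lambda>x. star a x y)" for a x y
    using assms unfolding products_linear_def bilinear_map_def by auto
  note comp = Vector_Spaces.linear_compose[unfolded o_def]
  show "bilinear_map sV sV sA (\<lambda>c d. star c (star d x y) z)"
    unfolding bilinear_map_def using lin(1) comp[OF lin(1) lin(3)] by blast
  show "bilinear_map sV sV sA (\<lambda>c d. star c x (star d y z))"
    unfolding bilinear_map_def using lin(1) comp[OF lin(1) lin(2)] by blast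
qed

theorem corollary4p12:
  fixes sV :: "'k::field \<Rightarrow> 'v::ab_group_add \<Rightarrow> 'v"
    and sV2 :: "'k \<Rightarrow> 'v2::ab_group_add \<Rightarrow> 'v2"
    and sV3 :: "'k \<Rightarrow> 'v3::ab_group_add \<Rightarrow> 'v3"
    and tens :: "'v \<Rightarrow> 'v \<Rightarrow> 'v2" and tensL :: "'v \<Rightarrow> 'v2 \<Rightarrow> 'v3" and tensR :: "'v2 \<Rightarrow> 'v \<Rightarrow> 'v3"
    and \<Phi> :: "'v2 \<Rightarrow> 'v2" and e1 e2 :: 'v
  assumes "lEAS sV sV2 sV3 tens tensL tensR \<Phi>"
    and "ordered_basis sV [e1, e2]"
    and "has_matrix sV2 [tens e1 e1, tens e1 e2, tens e2 e1, tens e2 e2] \<Phi>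
      (mat_of_rows_list 4
        [[1, 0, 0, 0],
         [0, 0, 1, 0],
         [0, 0, 0, 0],
         [0, 0, 0, 1]])"
  shows "(\<forall>(sA :: 'k \<Rightarrow> 'a::ab_group_add \<Rightarrow> 'a) star.
      Phi_associative sV sV2 tens \<Phi> sA star \<longrightarrow> duplicial sA (star e1) (star e2)) \<and>
    (\<forall>(sA :: 'k \<Rightarrow> 'a \<Rightarrow> 'a) star.
      opposite_Phi_associative sV sV2 tens \<Phi> sA star \<longrightarrow> duplicial sA (star e2) (star e1))"
proof -
  interpret lEAS sV sV2 sV3 tens tensL tensR \<Phi> by (rule assms(1))
  have "vector_space sV2" by unfold_locales
  note \<Phi> = matrix_values[OF this assms(3)]
  show ?thesis
  proof (intro conjI allI impI)
    fix sA :: "'k \<Rightarrow> 'a \<Rightarrow> 'a" and star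
    assume A: "Phi_associative sV sV2 tens \<Phi> sA star"
    then have pl: "products_linear sV sA star" and vs: "vector_space sA"
      by (auto simp: Phi_associative_def products_linear_def)
    \<comment> \<open>The lift evaluated at a single pure tensor: c indexes the outer product, d the
      inner one.\<close>
    have eq: "star a x (star b y z) = star c (star d x y) z"
      if "\<Phi> (tens a b) = tens c d" for a b c d x y z
      using A that V2.tensor_lift_tens[OF vs bilinear_map_products(1)[OF pl]]
      unfolding Phi_associative_def by simp
    \<comment> \<open>The column of e2 \<otimes> e1 gives
      \<open>star e2 x (star e1 y z) = star e1 (star e2 x y) z\<close>, the mixed law with
      \<open>star e2\<close> as \<succ>.\<close>
    show "duplicial sA (star e1) (star e2)"
      using pl eq[OF \<Phi>(1)] eq[OF \<Phi>(3)] eq[OF \<Phi>(4)]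
      unfolding duplicial_def products_linear_def by simp
  next
    fix sA :: "'k \<Rightarrow> 'a \<Rightarrow> 'a" and star
    assume A: "opposite_Phi_associative sV sV2 tens \<Phi> sA star"
    then have pl: "products_linear sV sA star" and vs: "vector_space sA"
      by (auto simp: opposite_Phi_associative_def products_linear_def)
    have eq: "star a (star b x y) z = star c x (star d y z)"
      if "\<Phi> (tens a b) = tens c d" for a b c d x y z
      using A that V2.tensor_lift_tens[OF vs bilinear_map_products(2)[OF pl]]
      unfolding opposite_Phi_associative_def by metis
    \<comment> \<open>With the bracketing reversed, the same column gives
      \<open>star e2 (star e1 x y) z = star e1 x (star e2 y z)\<close>. Now \<open>star e1\<close>
      has to be \<succ>, which is why the two products trade roles.\<close>
    show "duplicial sA (star e2) (star e1)"
      using pl eq[OF \<Phi>(1)] eq[OF \<Phi>(3)] eq[OF \<Phi>(4)]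
      unfolding duplicial_def products_linear_def by simp
  qed
qed

end
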